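(* Let $R$ be a commutative ring. Then the following are equivalent: (1) $R$ is strongly $J$-clean. (2) $T_n(R)$ is perfectly $J$-clean for all $n\in\mathbb{N}$. (3) $T_n(R)$ is perfectly $J$-clean for some $n\in\mathbb{N}$.
   Context: Rings are associative with identity; $\mathbb{N}$ is the set of positive integers. $J(S)$ is the Jacobson radical of a ring $S$. For $a\in S$, $comm(a)=\{x\in S\mid xa=ax\}$ and $comm^2(a)=\{x\in S\mid xy=yx \text{ for all } y\in comm(a)\}$. A ring $S$ is perfectly $J$-clean if for every $a\in S$ there is an idempotent $e\in comm^2(a)$ with $a-e\in J(S)$. A ring $S$ is strongly $J$-clean if for every $a\in S$ there is an idempotent $e\in comm(a)$ with $a-e\in J(S)$. $T_n(R)$ is the ring of $n\times n$ upper triangular matrices over $R$. *)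

theory Defs
  imports "HOL-Algebra.Ring" "HOL-Algebra.AbelCoset" "Jordan_Normal_Form.Matrix"
begin

definition left_ideal :: "'a set \<Rightarrow> ('a, 'm) ring_scheme \<Rightarrow> bool" where
  "left_ideal I S \<longleftrightarrow>
     additive_subgroup I S \<and> (\<forall>x\<in>carrier S. \<forall>a\<in>I. x \<otimes>\<^bsub>S\<^esub> a \<in> I)"

definition maximal_left_ideal :: "'a set \<Rightarrow> ('a, 'm) ring_scheme \<Rightarrow> bool" where
  "maximal_left_ideal I S \<longleftrightarrow>
     left_ideal I S \<and> I \<noteq> carrier S \<and>
     (\<forall>K. left_ideal K S \<and> I \<subseteq> K \<longrightarrow> K = I \<or> K = carrier S)"

text \<open>The explicit restriction to the carrier matters for the zero ring, which has no
  maximal left ideals: its radical is the whole ring.\<close>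

definition jacobson_radical :: "('a, 'm) ring_scheme \<Rightarrow> 'a set" where
  "jacobson_radical S = {x \<in> carrier S. \<forall>M. maximal_left_ideal M S \<longrightarrow> x \<in> M}"

definition comm :: "('a, 'm) ring_scheme \<Rightarrow> 'a \<Rightarrow> 'a set" where
  "comm S a = {x \<in> carrier S. x \<otimes>\<^bsub>S\<^esub> a = a \<otimes>\<^bsub>S\<^esub> x}"

definition comm2 :: "('a, 'm) ring_scheme \<Rightarrow> 'a \<Rightarrow> 'a set" where
  "comm2 S a = {x \<in> carrier S. \<forall>y\<in>comm S a. x \<otimes>\<^bsub>S\<^esub> y = y \<otimes>\<^bsub>S\<^esub> x}"

definition perfectly_J_clean :: "('a, 'm) ring_scheme \<Rightarrow> bool" where
  "perfectly_J_clean S \<longleftrightarrow>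
     (\<forall>a\<in>carrier S. \<exists>e\<in>comm2 S a. e \<otimes>\<^bsub>S\<^esub> e = e \<and> a \<ominus>\<^bsub>S\<^esub> e \<in> jacobson_radical S)"

definition strongly_J_clean :: "('a, 'm) ring_scheme \<Rightarrow> bool" where
  "strongly_J_clean S \<longleftrightarrow>
     (\<forall>a\<in>carrier S. \<exists>e\<in>comm S a. e \<otimes>\<^bsub>S\<^esub> e = e \<and> a \<ominus>\<^bsub>S\<^esub> e \<in> jacobson_radical S)"

text \<open>The arithmetic on \<^typ>\<open>'a mat\<close> provided by the library comes from type classes on
  \<^typ>\<open>'a\<close>. Here the entries lie in a ring with explicit carrier, so only the data type of
  matrices (with row and column indices starting at 0) is reused.\<close>

definition matrix_ring :: "nat \<Rightarrow> ('a, 'm) ring_scheme \<Rightarrow> 'a mat ring" where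
  "matrix_ring n R =
     \<lparr>carrier = {A \<in> carrier_mat n n. elements_mat A \<subseteq> carrier R},
      monoid.mult = (\<lambda>A B. mat n n (\<lambda>(i, j). \<Oplus>\<^bsub>R\<^esub>k\<in>{..<n}. A $$ (i, k) \<otimes>\<^bsub>R\<^esub> B $$ (k, j))),
      one = mat n n (\<lambda>(i, j). if i = j then \<one>\<^bsub>R\<^esub> else \<zero>\<^bsub>R\<^esub>),
      zero = mat n n (\<lambda>(i, j). \<zero>\<^bsub>R\<^esub>),
      add = (\<lambda>A B. mat n n (\<lambda>(i, j). A $$ (i, j) \<oplus>\<^bsub>R\<^esub> B $$ (i, j)))\<rparr>"

definition triangular_ring :: "nat \<Rightarrow> ('a, 'm) ring_scheme \<Rightarrow> 'a mat ring" where
  "triangular_ring n R = (matrix_ring n R)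
     \<lparr>carrier := {A \<in> carrier (matrix_ring n R). \<forall>i<n. \<forall>j<i. A $$ (i, j) = \<zero>\<^bsub>R\<^esub>}\<rparr>"

end

theory Submission
  imports Defs "Jordan_Normal_Form.Missing_Ring" "HOL-Algebra.Subrings"
begin

text \<open>Suppose \<open>R\<close> is strongly \<open>J\<close>-clean, let \<open>A\<close> be triangular with diagonal entries \<open>a i\<close>, and choose
  idempotents \<open>e i\<close> with \<open>a i - e i\<close> in the radical. The double commutant of \<open>A\<close> is a commutative
  ring containing \<open>A\<close> and all scalar matrices. For any two indices \<open>i, j\<close> it contains a matrix
  \<open>e i + c (A - a i)\<close> whose \<open>i\<close>-th and \<open>j\<close>-th diagonal entries are \<open>e i\<close> and \<open>e j\<close>; the polynomial
  \<open>xy + yz + zx - 2xyz\<close>, a majority operation on idempotents, combines these into one matrix with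
  diagonal \<open>e\<close>. That matrix is idempotent up to a nilpotent error, so it can be corrected within the
  double commutant to an idempotent \<open>E\<close> with the same diagonal. Then \<open>A - E\<close> has its diagonal in the
  radical of \<open>R\<close>, hence lies in the radical of the triangular ring.

  Conversely, reading off the first diagonal entry is a surjective ring homomorphism, and such
  homomorphisms map the radical into the radical.\<close>

section \<open>The Jacobson radical\<close>

context ring
begin

text \<open>Closure under negation comes from closure under left multiplication, since -x = (-1)
  x.\<close>

lemma left_idealI:
  assumes "I \<subseteq> carrier R" "\<zero> \<in> I"
    and "\<And>x y. x \<in> I \<Longrightarrow> y \<in> I \<Longrightarrow> x \<oplus> y \<in> I"
    and "\<And>x y. x \<in> carrier R \<Longrightarrow> y \<in> I \<Longrightarrow> x \<otimes> y \<in> I"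
  shows "left_ideal I R"
proof -
  have "\<ominus> x \<in> I" if "x \<in> I" for x
  proof -
    have "\<ominus> \<one> \<otimes> x = \<ominus> x"
      using that assms(1) by (simp add: l_minus subset_iff)
    then show ?thesis
      using assms(4)[of "\<ominus> \<one>" x] that by simp
  qed
  then have "additive_subgroup I R"
    using assms(1-3) by (intro additive_subgroup.intro add.subgroupI) auto
  then show ?thesis
    using assms by (auto simp: left_ideal_def)
qed

lemma left_idealE:
  assumes "left_ideal I R"
  shows "I \<subseteq> carrier R" "\<zero> \<in> I"
    and "\<And>x y. x \<in> I \<Longrightarrow> y \<in> I \<Longrightarrow> x \<oplus> y \<in> I"
    and "\<And>x y. x \<in> I \<Longrightarrow> y \<in> I \<Longrightarrow> x \<ominus> y \<in> I"
    and "\<And>x y. x \<in> carrier R \<Longrightarrow> y \<in> I \<Longrightarrow> x \<otimes> y \<in> I"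
proof -
  interpret additive_subgroup I R
    using assms by (simp add: left_ideal_def)
  show "I \<subseteq> carrier R" "\<zero> \<in> I"
    and "\<And>x y. x \<in> I \<Longrightarrow> y \<in> I \<Longrightarrow> x \<oplus> y \<in> I"
    and "\<And>x y. x \<in> I \<Longrightarrow> y \<in> I \<Longrightarrow> x \<ominus> y \<in> I"
    and "\<And>x y. x \<in> carrier R \<Longrightarrow> y \<in> I \<Longrightarrow> x \<otimes> y \<in> I"
    using assms a_subset
    by (auto simp: left_ideal_def a_minus_def)
qed

lemma left_ideal_eq_carrier:
  assumes "left_ideal I R" "\<one> \<in> I"
  shows "I = carrier R"
  using left_idealE(1,5)[OF assms(1)] assms(2) by (metis r_one subsetI subset_antisym)

lemma maximal_left_idealD:
  assumes "maximal_left_ideal M R"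
  shows "left_ideal M R" "\<one> \<notin> M"
  using assms left_ideal_eq_carrier by (auto simp: maximal_left_ideal_def)

lemma left_ideal_principal:
  assumes "x \<in> carrier R"
  shows "left_ideal {y \<otimes> x |y. y \<in> carrier R} R"
proof (rule left_idealI)
  show "\<zero> \<in> {y \<otimes> x |y. y \<in> carrier R}"
    using assms by (force intro: exI[of _ \<zero>])
  show "a \<oplus> b \<in> {y \<otimes> x |y. y \<in> carrier R}"
    if ab: "a \<in> {y \<otimes> x |y. y \<in> carrier R}" "b \<in> {y \<otimes> x |y. y \<in> carrier R}" for a b
  proof -
    obtain y z where "y \<in> carrier R" "z \<in> carrier R" "a = y \<otimes> x" "b = z \<otimes> x"
      using ab by auto
    then have "a \<oplus> b = (y \<oplus> z) \<otimes> x" "y \<oplus> z \<in> carrier R"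
      using assms by (auto simp: l_distr)
    then show ?thesis by blast
  qed
  show "a \<otimes> b \<in> {y \<otimes> x |y. y \<in> carrier R}"
    if ab: "a \<in> carrier R" "b \<in> {y \<otimes> x |y. y \<in> carrier R}" for a b
    using ab assms by (auto simp flip: m_assoc)
qed (use assms in auto)

lemma left_ideal_sum:
  assumes I: "left_ideal I R" and K: "left_ideal K R"
  shows "left_ideal {x \<oplus> y |x y. x \<in> I \<and> y \<in> K} R"
proof (rule left_idealI)
  note I' = left_idealE[OF I] and K' = left_idealE[OF K]
  show "{x \<oplus> y |x y. x \<in> I \<and> y \<in> K} \<subseteq> carrier R"
    using I'(1) K'(1) by auto
  show "\<zero> \<in> {x \<oplus> y |x y. x \<in> I \<and> y \<in> K}"
    using I'(2) K'(2) by (force intro: exI[of _ \<zero>])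
  show "a \<oplus> b \<in> {x \<oplus> y |x y. x \<in> I \<and> y \<in> K}"
    if ab: "a \<in> {x \<oplus> y |x y. x \<in> I \<and> y \<in> K}" "b \<in> {x \<oplus> y |x y. x \<in> I \<and> y \<in> K}" for a b
  proof -
    obtain x y x' y' where *: "x \<in> I" "y \<in> K" "x' \<in> I" "y' \<in> K" "a = x \<oplus> y" "b = x' \<oplus> y'"
      using ab by auto
    moreover from this have "x \<in> carrier R" "y \<in> carrier R" "x' \<in> carrier R" "y' \<in> carrier R"
      using I'(1) K'(1) by auto
    then have "(x \<oplus> y) \<oplus> (x' \<oplus> y') = (x \<oplus> x') \<oplus> (y \<oplus> y')"
      by algebra
    ultimately show ?thesis
      using I'(3) K'(3) by blast
  qed
  show "a \<otimes> b \<in> {x \<oplus> y |x y. x \<in> I \<and> y \<in> K}"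
    if ab: "a \<in> carrier R" "b \<in> {x \<oplus> y |x y. x \<in> I \<and> y \<in> K}" for a b
  proof -
    obtain x y where *: "x \<in> I" "y \<in> K" "b = x \<oplus> y"
      using ab by auto
    then have "a \<otimes> b = a \<otimes> x \<oplus> a \<otimes> y"
      using I'(1) K'(1) ab(1) by (auto intro!: r_distr)
    then show ?thesis
      using I'(5) K'(5) * ab(1) by blast
  qed
qed

lemma left_ideal_Union_chain:
  assumes "C \<noteq> {}" "\<And>I. I \<in> C \<Longrightarrow> left_ideal I R"
    and "\<And>I K. I \<in> C \<Longrightarrow> K \<in> C \<Longrightarrow> I \<subseteq> K \<or> K \<subseteq> I"
  shows "left_ideal (\<Union>C) R"
proof (rule left_idealI)
  show "\<Union>C \<subseteq> carrier R"
    using left_idealE(1)[OF assms(2)] by (rule Union_least)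
  obtain I where "I \<in> C"
    using assms(1) by blast
  then show "\<zero> \<in> \<Union>C"
    using left_idealE(2)[OF assms(2)] by (intro UnionI)
  show "x \<oplus> y \<in> \<Union>C" if "x \<in> \<Union>C" "y \<in> \<Union>C" for x y
  proof -
    obtain I K where IK: "I \<in> C" "K \<in> C" "x \<in> I" "y \<in> K"
      using \<open>x \<in> \<Union>C\<close> \<open>y \<in> \<Union>C\<close> by (elim UnionE)
    then obtain L where "L \<in> C" "x \<in> L" "y \<in> L"
      using assms(3)[OF IK(1,2)] by (elim disjE) (simp_all add: subset_iff)
    then show ?thesis
      using left_idealE(3)[OF assms(2)] by (intro UnionI)
  qed
  show "x \<otimes> y \<in> \<Union>C" if "x \<in> carrier R" "y \<in> \<Union>C" for x y
    using that left_idealE(5)[OF assms(2)] by (elim UnionE) (intro UnionI)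
qed

text \<open>Zorn's lemma is applied to the left ideals that contain \<open>I\<close> and avoid 1.
  Expressing properness by the absence of 1 makes it pass to unions of chains.\<close>

lemma exists_maximal_left_ideal:
  assumes "left_ideal I R" "\<one> \<notin> I"
  shows "\<exists>M. maximal_left_ideal M R \<and> I \<subseteq> M"
proof -
  let ?A = "{K. left_ideal K R \<and> \<one> \<notin> K \<and> I \<subseteq> K}"
  have "\<exists>M\<in>?A. \<forall>K\<in>?A. M \<subseteq> K \<longrightarrow> K = M"
  proof (rule subset_Zorn_nonempty)
    show "?A \<noteq> {}"
      using assms by auto
    show "\<Union>C \<in> ?A" if C: "C \<noteq> {}" "subset.chain ?A C" for C
    proof -
      have C': "left_ideal K R" "\<one> \<notin> K" "I \<subseteq> K" if "K \<in> C" for K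
        using C(2) that unfolding subset_chain_def by auto
      have "left_ideal (\<Union>C) R"
        using C C' by (intro left_ideal_Union_chain) (auto simp: subset_chain_def)
      then show ?thesis
        using C(1) C'(2,3) by auto
    qed
  qed
  then obtain M where M: "left_ideal M R" "\<one> \<notin> M" "I \<subseteq> M"
    and max: "\<forall>K\<in>?A. M \<subseteq> K \<longrightarrow> K = M"
    by auto
  have "maximal_left_ideal M R"
    unfolding maximal_left_ideal_def
  proof (intro conjI allI impI)
    show "M \<noteq> carrier R"
      using M(2) by auto
    show "K = M \<or> K = carrier R" if "left_ideal K R \<and> M \<subseteq> K" for K
      using that max M(3) left_ideal_eq_carrier[of K] by (cases "\<one> \<in> K") auto
  qed (fact M(1))
  then show ?thesis
    using M(3) by blast
qed

section \<open>The radical described by left invertibility\<close>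

lemma left_ideal_jacobson_radical: "left_ideal (jacobson_radical R) R"
  by (rule left_idealI)
    (auto simp: jacobson_radical_def intro: left_idealE[OF maximal_left_idealD(1)])

text \<open>Without a left inverse, the left ideal generated by 1 + x would avoid 1 and so lie in a
  maximal one. That maximal left ideal contains x as well, hence 1.\<close>

lemma jacobson_radical_left_inverse:
  assumes "x \<in> jacobson_radical R"
  shows "\<exists>v\<in>carrier R. v \<otimes> (\<one> \<oplus> x) = \<one>"
proof (rule ccontr)
  assume no_inv: "\<not> ?thesis"
  have x: "x \<in> carrier R"
    using assms by (simp add: jacobson_radical_def)
  let ?L = "{v \<otimes> (\<one> \<oplus> x) |v. v \<in> carrier R}"
  have "left_ideal ?L R" "\<one> \<notin> ?L"
    using left_ideal_principal x no_inv by auto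
  then obtain M where M: "maximal_left_ideal M R" "?L \<subseteq> M"
    using exists_maximal_left_ideal by blast
  have "\<one> \<oplus> x \<in> ?L"
    using x by (auto intro!: exI[of _ \<one>])
  moreover have "x \<in> M"
    using assms M(1) by (simp add: jacobson_radical_def)
  ultimately have "(\<one> \<oplus> x) \<ominus> x \<in> M"
    using M left_idealE(4) maximal_left_idealD(1) by blast
  moreover have "(\<one> \<oplus> x) \<ominus> x = \<one>"
    using x by algebra
  ultimately show False
    using maximal_left_idealD(2)[OF M(1)] by simp
qed

text \<open>If x missed a maximal left ideal M, then M + Rx would be the whole ring and 1 = m + yx
  with m in M. The hypothesis at -y makes m = 1 - yx left invertible, which forces 1 into M.\<close>

lemma jacobson_radicalI:
  assumes x: "x \<in> carrier R"
    and inv: "\<And>y. y \<in> carrier R \<Longrightarrow> \<exists>v\<in>carrier R. v \<otimes> (\<one> \<oplus> y \<otimes> x) = \<one>"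
  shows "x \<in> jacobson_radical R"
proof -
  have "x \<in> M" if M: "maximal_left_ideal M R" for M
  proof (rule ccontr)
    assume "x \<notin> M"
    note M' = maximal_left_idealD[OF M]
    note ME = left_idealE[OF M'(1)]
    define P where "P = {y \<otimes> x |y. y \<in> carrier R}"
    define K where "K = {m \<oplus> z |m z. m \<in> M \<and> z \<in> P}"
    have P: "left_ideal P R"
      unfolding P_def using x by (rule left_ideal_principal)
    have K: "left_ideal K R"
      unfolding K_def using M'(1) P by (rule left_ideal_sum)
    have KI: "m \<oplus> z \<in> K" if "m \<in> M" "z \<in> P" for m z
      using that by (auto simp: K_def)
    have "m \<in> K" if "m \<in> M" for m
      using KI[OF that left_idealE(2)[OF P]] that ME(1) by (simp add: subset_iff)
    moreover have "x \<in> P"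
      using x by (auto simp: P_def intro!: exI[of _ \<one>])
    then have "x \<in> K"
      using KI[OF ME(2)] x by force
    ultimately have "M \<subseteq> K" "K \<noteq> M"
      using \<open>x \<notin> M\<close> by auto
    then have "K = carrier R"
      using M K unfolding maximal_left_ideal_def by metis
    then have "\<one> \<in> K"
      by simp
    then obtain m y where my: "m \<in> M" "y \<in> carrier R" "\<one> = m \<oplus> y \<otimes> x"
      unfolding K_def P_def by auto
    have mc: "m \<in> carrier R" using my(1) ME(1) by blast
    obtain v where v: "v \<in> carrier R" "v \<otimes> (\<one> \<oplus> (\<ominus> y) \<otimes> x) = \<one>"
      using inv[OF a_inv_closed[OF my(2)]] by (elim bexE)
    have "\<one> \<oplus> (\<ominus> y) \<otimes> x = (m \<oplus> y \<otimes> x) \<oplus> (\<ominus> y) \<otimes> x"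
      by (simp only: my(3)[symmetric])
    also have "\<dots> = m"
      using mc my(2) x by algebra
    finally have "v \<otimes> m = \<one>" using v(2) by simp
    then show False
      using ME(5)[OF v(1) my(1)] M'(2) by simp
  qed
  then show ?thesis
    using x by (simp add: jacobson_radical_def)
qed

text \<open>The left inverse is the geometric series 1 + N + ... + N^(k-1).\<close>

lemma unipotent_left_inverse:
  assumes N: "N \<in> carrier R" and nil: "N [^] (k::nat) = \<zero>"
  shows "\<exists>w\<in>carrier R. w \<otimes> (\<one> \<ominus> N) = \<one>"
proof -
  \<comment> \<open>The telescoping identity is proved for every exponent, with a local
    \<open>k\<close>. Nilpotency enters at the end, where the power of \<open>N\<close>
    vanishes.\<close>
  have "\<exists>w\<in>carrier R. w \<otimes> (\<one> \<ominus> N) = \<one> \<ominus> N [^] k" for k :: nat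
  proof (induction k)
    case 0
    then show ?case
      using N by (intro bexI[of _ \<zero>]) (auto simp: r_neg a_minus_def)
  next
    case (Suc k)
    then obtain w where w: "w \<in> carrier R" "w \<otimes> (\<one> \<ominus> N) = \<one> \<ominus> N [^] k"
      by blast
    have p: "N [^] k \<in> carrier R"
      using N by simp
    have "(w \<oplus> N [^] k) \<otimes> (\<one> \<ominus> N) = w \<otimes> (\<one> \<ominus> N) \<oplus> N [^] k \<otimes> (\<one> \<ominus> N)"
      using N w(1) p by (simp add: l_distr)
    also have "N [^] k \<otimes> (\<one> \<ominus> N) = N [^] k \<ominus> N [^] k \<otimes> N"
      using N p by (simp add: a_minus_def r_distr r_minus)
    also have "w \<otimes> (\<one> \<ominus> N) \<oplus> (N [^] k \<ominus> N [^] k \<otimes> N) = \<one> \<ominus> N [^] k \<otimes> N"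
      unfolding w(2) using N p by algebra
    finally show ?case
      using w(1) p by (intro bexI[of _ "w \<oplus> N [^] k"]) simp_all
  qed
  from this[of k] show ?thesis
    using nil by (simp add: a_minus_def)
qed

end

lemma ring_hom_minus:
  assumes "ring S" "ring R" "h \<in> Ring.ring_hom S R" "x \<in> carrier S" "y \<in> carrier S"
  shows "h (x \<ominus>\<^bsub>S\<^esub> y) = h x \<ominus>\<^bsub>R\<^esub> h y"
proof -
  interpret ring_hom_ring S R h
    using assms by (simp add: ring_hom_ringI2)
  show ?thesis using assms by (simp add: a_minus_def)
qed

text \<open>The left inverse criterion is transported directly: y lifts to some z, and
  \<open>h\<close> maps a left inverse of 1 + zx to one of 1 + y h(x).\<close>

lemma surj_ring_hom_jacobson_radical:
  assumes "ring S" "ring R" and h: "h \<in> Ring.ring_hom S R" and surj: "h ` carrier S = carrier R"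
    and x: "x \<in> jacobson_radical S"
  shows "h x \<in> jacobson_radical R"
proof -
  interpret S: ring S by fact
  interpret R: ring R by fact
  note hom = ring_hom_closed[OF h] ring_hom_mult[OF h] ring_hom_add[OF h] ring_hom_one[OF h]
    ring_hom_zero[OF h assms(1,2)] ring_hom_minus[OF assms(1,2) h]
  have xS: "x \<in> carrier S" using x by (simp add: jacobson_radical_def)
  show ?thesis
  proof (rule R.jacobson_radicalI)
    show "h x \<in> carrier R" using hom(1) xS .
    fix y assume "y \<in> carrier R"
    then obtain z where z: "z \<in> carrier S" "y = h z" using surj by blast
    have "z \<otimes>\<^bsub>S\<^esub> x \<in> jacobson_radical S"
      using S.left_idealE(5)[OF S.left_ideal_jacobson_radical z(1) x] .
    then obtain v where v: "v \<in> carrier S" "v \<otimes>\<^bsub>S\<^esub> (\<one>\<^bsub>S\<^esub> \<oplus>\<^bsub>S\<^esub> z \<otimes>\<^bsub>S\<^esub> x) = \<one>\<^bsub>S\<^esub>"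
      using S.jacobson_radical_left_inverse by blast
    have "h v \<otimes>\<^bsub>R\<^esub> (\<one>\<^bsub>R\<^esub> \<oplus>\<^bsub>R\<^esub> y \<otimes>\<^bsub>R\<^esub> h x) = h (v \<otimes>\<^bsub>S\<^esub> (\<one>\<^bsub>S\<^esub> \<oplus>\<^bsub>S\<^esub> z \<otimes>\<^bsub>S\<^esub> x))"
      using z v(1) xS by (simp add: hom)
    then show "\<exists>v\<in>carrier R. v \<otimes>\<^bsub>R\<^esub> (\<one>\<^bsub>R\<^esub> \<oplus>\<^bsub>R\<^esub> y \<otimes>\<^bsub>R\<^esub> h x) = \<one>\<^bsub>R\<^esub>"
      using v hom(1,4) by metis
  qed
qed

section \<open>Lifting idempotents in commutative rings\<close>

text \<open>The last bracket is 2xyz. The polynomial serves twice: with distinct arguments it merges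
  interpolants, with equal ones it improves an approximate idempotent.\<close>

definition majority :: "('a, 'm) ring_scheme \<Rightarrow> 'a \<Rightarrow> 'a \<Rightarrow> 'a \<Rightarrow> 'a" where
  "majority S x y z =
     (x \<otimes>\<^bsub>S\<^esub> y \<oplus>\<^bsub>S\<^esub> y \<otimes>\<^bsub>S\<^esub> z \<oplus>\<^bsub>S\<^esub> z \<otimes>\<^bsub>S\<^esub> x) \<ominus>\<^bsub>S\<^esub>
     (x \<otimes>\<^bsub>S\<^esub> y \<otimes>\<^bsub>S\<^esub> z \<oplus>\<^bsub>S\<^esub> x \<otimes>\<^bsub>S\<^esub> y \<otimes>\<^bsub>S\<^esub> z)"

context cring
begin

lemma majority_closed [simp]:
  "x \<in> carrier R \<Longrightarrow> y \<in> carrier R \<Longrightarrow> z \<in> carrier R \<Longrightarrow> majority R x y z \<in> carrier R"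
  by (simp add: majority_def)

text \<open>With p = xy, idempotency of x turns the polynomial into x + 2p - 2p. The odd argument y
  is arbitrary, which matters for interpolation, where the dissenting value is uncontrolled.\<close>

lemma majority_idem:
  assumes "x \<in> carrier R" "y \<in> carrier R" "x \<otimes> x = x"
  shows "majority R x x y = x" "majority R x y x = x" "majority R y x x = x"
proof -
  have *: "x \<oplus> p \<oplus> p \<ominus> (p \<oplus> p) = x" "p \<oplus> p \<oplus> x \<ominus> (p \<oplus> p) = x" "p \<oplus> x \<oplus> p \<ominus> (p \<oplus> p) = x"
    if "p \<in> carrier R" for p
    using assms(1) that by algebra+
  have x: "x \<otimes> (x \<otimes> y) = x \<otimes> y"
    using assms m_assoc by metis
  show "majority R x x y = x" "majority R x y x = x" "majority R y x x = x"
    unfolding majority_def using assms * by (simp_all add: m_ac x)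
qed

text \<open>The defect of the new element is a multiple of u^2, so iterating the step kills a
  nilpotent defect.\<close>

lemma majority_defect:
  assumes x: "x \<in> carrier R" and u: "u = x \<otimes> x \<ominus> x" and w: "w = majority R x x x"
  shows "w \<otimes> w \<ominus> w = u \<otimes> u \<otimes> ((u \<oplus> u \<oplus> u \<oplus> u) \<ominus> (\<one> \<oplus> \<one> \<oplus> \<one>))"
proof -
  have uc: "u \<in> carrier R" using x u by simp
  have xx: "x \<otimes> x = x \<oplus> u" using x unfolding u by algebra
  have w': "w = x \<oplus> u \<ominus> (x \<otimes> u \<oplus> x \<otimes> u)"
  proof -
    have "w = (x \<oplus> u) \<oplus> (x \<oplus> u) \<oplus> (x \<oplus> u) \<ominus> ((x \<oplus> u) \<otimes> x \<oplus> (x \<oplus> u) \<otimes> x)"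
      unfolding w majority_def xx ..
    also have "(x \<oplus> u) \<otimes> x = x \<oplus> u \<oplus> x \<otimes> u"
      using x uc xx by (simp only: l_distr m_comm[of u x])
    finally show ?thesis using x uc by algebra
  qed
  \<comment> \<open>Up to sign, t = 1 - 2x is the derivative of x^2 - x. The step becomes w = x +
    tu, and t^2 = 1 + 4u eliminates x from the defect.\<close>
  define t where "t = \<one> \<ominus> (x \<oplus> x)"
  have tc: "t \<in> carrier R" using x by (simp add: t_def)
  have "t \<otimes> t = \<one> \<ominus> (x \<oplus> x \<oplus> x \<oplus> x) \<oplus> (x \<otimes> x \<oplus> x \<otimes> x \<oplus> x \<otimes> x \<oplus> x \<otimes> x)"
    unfolding t_def using x by algebra
  also have "\<dots> = \<one> \<oplus> (u \<oplus> u \<oplus> u \<oplus> u)"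
    unfolding xx using x uc by algebra
  finally have tt: "t \<otimes> t = \<one> \<oplus> (u \<oplus> u \<oplus> u \<oplus> u)" .
  have wt: "w = x \<oplus> t \<otimes> u"
    unfolding w' t_def using x uc by algebra
  have "w \<otimes> w \<ominus> w = x \<otimes> x \<ominus> x \<oplus> (x \<oplus> x) \<otimes> t \<otimes> u \<ominus> t \<otimes> u \<oplus> t \<otimes> t \<otimes> (u \<otimes> u)"
    unfolding wt using x uc tc by algebra
  also have "\<dots> = u \<ominus> t \<otimes> t \<otimes> u \<oplus> t \<otimes> t \<otimes> (u \<otimes> u)"
  proof -
    have "t \<otimes> t \<otimes> u = t \<otimes> u \<ominus> (x \<oplus> x) \<otimes> t \<otimes> u"
      using x uc tc by (subst (1) t_def) algebra
    then show ?thesis using x uc tc unfolding u[symmetric] by algebra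
  qed
  also have "\<dots> = u \<otimes> u \<otimes> ((u \<oplus> u \<oplus> u \<oplus> u) \<ominus> (\<one> \<oplus> \<one> \<oplus> \<one>))"
    unfolding tt using uc by algebra
  finally show ?thesis .
qed

lemma majority_hom:
  assumes "cring S" "h \<in> Ring.ring_hom R S" "x \<in> carrier R" "y \<in> carrier R" "z \<in> carrier R"
  shows "h (majority R x y z) = majority S (h x) (h y) (h z)"
proof -
  interpret S: cring S by fact
  show ?thesis
    using assms ring_hom_minus[OF ring_axioms S.ring_axioms assms(2)]
    by (simp add: majority_def ring_hom_add[OF assms(2)] ring_hom_mult[OF assms(2)])
qed

text \<open>The Newton step \<open>x \<mapsto> 3 x^2 - 2 x^3\<close> is \<open>majority x x x\<close>.\<close>

lemma lift_idempotent:
  assumes S: "cring S"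
    and d: "\<And>i. i \<in> I \<Longrightarrow> d i \<in> Ring.ring_hom R S"
    and "x \<in> carrier R" "(x \<otimes> x \<ominus> x) [^] (k::nat) = \<zero>"
    and "\<And>i. i \<in> I \<Longrightarrow> d i x \<otimes>\<^bsub>S\<^esub> d i x = d i x"
  shows "\<exists>e\<in>carrier R. e \<otimes> e = e \<and> (\<forall>i\<in>I. d i e = d i x)"
  using assms(3-)
proof (induction k arbitrary: x rule: less_induct)
  case (less k)
  interpret S: cring S by fact
  define u where "u = x \<otimes> x \<ominus> x"
  have u: "u \<in> carrier R" "u [^] k = \<zero>"
    using less.prems by (simp_all add: u_def)
  have xx: "x \<otimes> x = x" if "u = \<zero>"
    using that less.prems(1) by (simp add: u_def)
  \<comment> \<open>Exponents 0 and 1 both force u = 0, exponent 0 by making the ring trivial, so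
    there x is already idempotent.\<close>
  consider "k \<le> 1" | "k \<ge> 2" by linarith
  then show ?case
  proof cases
    case 1
    then consider "k = 0" | "k = 1" by linarith
    then have "u = \<zero>"
    proof cases
      case 1
      then have "\<one> = \<zero>" using u by simp
      then show ?thesis using u one_zeroD by auto
    qed (use u in simp)
    then show ?thesis using xx less.prems(1) by blast
  next
    case 2
    define w where "w = majority R x x x"
    define c where "c = (u \<oplus> u \<oplus> u \<oplus> u) \<ominus> (\<one> \<oplus> \<one> \<oplus> \<one>)"
    have c: "c \<in> carrier R" and w: "w \<in> carrier R"
      using u less.prems(1) by (simp_all add: c_def w_def)
    \<comment> \<open>A homomorphism turns w into the majority of three copies of the idempotent
      \<open>d i x\<close>, so the prescribed values survive the step.\<close>
    have dw: "d i w = d i x" if "i \<in> I" for i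
      using that majority_hom[OF S d[OF that]] S.majority_idem less.prems ring_hom_closed[OF d[OF that]]
      by (simp add: w_def)
    have "(w \<otimes> w \<ominus> w) [^] (k - 1) = (u [^] (2::nat) \<otimes> c) [^] (k - 1)"
      using majority_defect[OF less.prems(1) u_def w_def] u(1)
      by (simp add: c_def numeral_2_eq_2)
    also have "\<dots> = u [^] (2 * (k - 1)) \<otimes> c [^] (k - 1)"
      using u(1) c by (simp add: nat_pow_distrib nat_pow_pow)
    \<comment> \<open>Splitting off the exponent k is possible because k >= 2. The exponent thus
      drops to k - 1, which is enough for the induction.\<close>
    also have "2 * (k - 1) = k + (k - 2)"
      using 2 by simp
    also have "u [^] (k + (k - 2)) = \<zero>"
      using u by (simp add: nat_pow_mult[symmetric])
    finally have "(w \<otimes> w \<ominus> w) [^] (k - 1) = \<zero>"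
      using c by simp
    then obtain e where "e \<in> carrier R" "e \<otimes> e = e" "\<forall>i\<in>I. d i e = d i w"
      using less.IH[of "k - 1" w] 2 w dw less.prems(3) by auto
    then show ?thesis using dw by metis
  qed
qed

text \<open>A Baker--Pixley argument: given three points of \<open>I\<close>, interpolants on the complements
  of each of them agree in pairs at every point, so their majority interpolates on \<open>I\<close>.\<close>

lemma interpolate_idempotents:
  assumes S: "cring S"
    and d: "\<And>i. i \<in> I \<Longrightarrow> d i \<in> Ring.ring_hom R S"
    and e: "\<And>i. i \<in> I \<Longrightarrow> e i \<in> carrier S" "\<And>i. i \<in> I \<Longrightarrow> e i \<otimes>\<^bsub>S\<^esub> e i = e i"
    and pair: "\<And>i j. i \<in> I \<Longrightarrow> j \<in> I \<Longrightarrow> \<exists>x\<in>carrier R. d i x = e i \<and> d j x = e j"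
    and "finite I"
  shows "\<exists>x\<in>carrier R. \<forall>i\<in>I. d i x = e i"
proof -
  interpret S: cring S by fact
  have "\<exists>x\<in>carrier R. \<forall>i\<in>K. d i x = e i" if "finite K" "K \<subseteq> I" for K
    using that
  proof (induction "card K" arbitrary: K rule: less_induct)
    case less
    show ?case
    proof (cases "\<exists>i j. i \<in> I \<and> j \<in> I \<and> K \<subseteq> {i, j}")
      case True
      then obtain i j where "i \<in> I" "j \<in> I" and K: "K \<subseteq> {i, j}"
        by (elim exE conjE)
      then obtain x where "x \<in> carrier R" "d i x = e i" "d j x = e j"
        using pair by meson
      then show ?thesis
        using K by (intro bexI[of _ x]) auto
    next
      case False
      have third: "\<exists>l. l \<in> K \<and> l \<noteq> i \<and> l \<noteq> j" if "i \<in> K" "j \<in> K" for i j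
      proof (rule ccontr)
        assume "\<not> ?thesis"
        then have "K \<subseteq> {i, j}" by auto
        then show False using False that less.prems(2) by (meson subsetD)
      qed
      \<comment> \<open>Here \<open>K\<close> can be empty only if \<open>I\<close> is empty, since
        otherwise two points of \<open>I\<close>, possibly equal, would cover it. A nonempty
        \<open>K\<close> has three distinct points.\<close>
      consider "K = {}" | i j l where "i \<in> K" "j \<in> K" "l \<in> K" "i \<noteq> j" "i \<noteq> l" "j \<noteq> l"
      proof (cases "K = {}")
        case False
        then obtain i where i: "i \<in> K" by auto
        obtain j where j: "j \<in> K" "j \<noteq> i" using third[OF i i] by auto
        obtain l where "l \<in> K" "l \<noteq> i" "l \<noteq> j" using third[OF i j(1)] by auto
        with i j that(2) show thesis by metis
      qed
      then show ?thesis
      proof cases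
        case 1
        then show ?thesis by auto
      next
        case (2 i j l)
        have *: "\<forall>m\<in>K. \<exists>x. x \<in> carrier R \<and> (\<forall>h\<in>K - {m}. d h x = e h)"
        proof
          fix m assume "m \<in> K"
          then have "\<exists>x\<in>carrier R. \<forall>h\<in>K - {m}. d h x = e h"
            using less.prems by (intro less.hyps card_Diff1_less) auto
          then show "\<exists>x. x \<in> carrier R \<and> (\<forall>h\<in>K - {m}. d h x = e h)" by auto
        qed
        then obtain f where f: "\<And>m. m \<in> K \<Longrightarrow> f m \<in> carrier R"
            "\<And>m h. m \<in> K \<Longrightarrow> h \<in> K \<Longrightarrow> h \<noteq> m \<Longrightarrow> d h (f m) = e h"
        proof -
          obtain f where "\<forall>m\<in>K. f m \<in> carrier R \<and> (\<forall>h\<in>K - {m}. d h (f m) = e h)"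
            using bchoice[OF *] by (elim exE)
          then show thesis
            by (intro that[of f]) simp_all
        qed
        have "d h (majority R (f i) (f j) (f l)) = e h" if h: "h \<in> K" for h
        proof -
          have hI: "h \<in> I" using h less.prems by blast
          have cl: "d h (f m) \<in> carrier S" if "m \<in> K" for m
            using f(1)[OF that] ring_hom_closed[OF d[OF hI]] by simp
          have "d h (majority R (f i) (f j) (f l)) = majority S (d h (f i)) (d h (f j)) (d h (f l))"
            using majority_hom[OF S d[OF hI]] f(1) 2 by simp
          also have "\<dots> = e h"
          proof -
            \<comment> \<open>The point \<open>h\<close> equals at most one of \<open>i\<close>,
              \<open>j\<close>, \<open>l\<close>, so at least two of the interpolants are correct
              there.\<close>
            consider "d h (f i) = e h" "d h (f j) = e h" | "d h (f i) = e h" "d h (f l) = e h"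
              | "d h (f j) = e h" "d h (f l) = e h"
              using f(2)[OF _ h] 2 by metis
            then show ?thesis
              using cl[OF 2(1)] cl[OF 2(2)] cl[OF 2(3)] e[OF hI] S.majority_idem
              by cases simp_all
          qed
          finally show ?thesis .
        qed
        then show ?thesis
          using f(1)[OF 2(1)] f(1)[OF 2(2)] f(1)[OF 2(3)]
          by (intro bexI[of _ "majority R (f i) (f j) (f l)"]) simp_all
      qed
    qed
  qed
  then show ?thesis using \<open>finite I\<close> by blast
qed

text \<open>The solution is \<open>c = d^2 v\<close> with \<open>d = e' - e\<close> and \<open>v\<close> the inverse of
  \<open>1 + d (j' - j)\<close>, since \<open>d^3 = d\<close>.\<close>

lemma idempotent_difference_solve:
  assumes e: "e \<in> carrier R" "e \<otimes> e = e" and e': "e' \<in> carrier R" "e' \<otimes> e' = e'"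
    and j: "j \<in> jacobson_radical R" "j' \<in> jacobson_radical R"
  shows "\<exists>c\<in>carrier R. c \<otimes> ((e' \<oplus> j') \<ominus> (e \<oplus> j)) = e' \<ominus> e"
proof -
  note J = left_idealE[OF left_ideal_jacobson_radical]
  have jc: "j \<in> carrier R" "j' \<in> carrier R"
    using j J(1) by auto
  define d where "d = e' \<ominus> e"
  have d: "d \<in> carrier R" using e e' by (simp add: d_def)
  have "d \<otimes> (j' \<ominus> j) \<in> jacobson_radical R"
    using J(4,5) j d by blast
  then obtain v where v: "v \<in> carrier R" "v \<otimes> (\<one> \<oplus> d \<otimes> (j' \<ominus> j)) = \<one>"
    using jacobson_radical_left_inverse by blast
  \<comment> \<open>Both idempotents fix p = ee', so d^2 = e + e' - 2p; multiplying by d = e' - e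
    once more cancels the terms with p.\<close>
  have ddd: "d \<otimes> d \<otimes> d = d"
  proof -
    define p where "p = e \<otimes> e'"
    have p: "p \<in> carrier R" "p \<otimes> e = p" "p \<otimes> e' = p"
      using e e' by (simp_all add: p_def m_ac) (simp_all add: e e' flip: m_assoc)
    have "d \<otimes> d = e' \<otimes> e' \<oplus> e \<otimes> e \<ominus> (p \<oplus> p)"
      unfolding d_def p_def using e(1) e'(1) by algebra
    then have dd: "d \<otimes> d = e' \<oplus> e \<ominus> (p \<oplus> p)"
      by (simp only: e(2) e'(2))
    have "d \<otimes> d \<otimes> d = e' \<otimes> e' \<ominus> e \<otimes> e \<ominus> (p \<otimes> e' \<oplus> p \<otimes> e') \<oplus> (p \<otimes> e \<oplus> p \<otimes> e)"
      unfolding dd unfolding d_def using e(1) e'(1) p(1) by algebra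
    also have "\<dots> = d"
      unfolding e(2) e'(2) p(2,3) d_def using e(1) e'(1) p(1) by algebra
    finally show ?thesis .
  qed
  define g where "g = j' \<ominus> j"
  have g: "g \<in> carrier R"
    using jc by (simp add: g_def)
  have "(e' \<oplus> j') \<ominus> (e \<oplus> j) = d \<oplus> g"
    unfolding d_def g_def using e(1) e'(1) jc by algebra
  then have "(v \<otimes> (d \<otimes> d)) \<otimes> ((e' \<oplus> j') \<ominus> (e \<oplus> j)) = v \<otimes> (d \<otimes> d \<otimes> d \<oplus> d \<otimes> g \<otimes> d)"
    using d g v(1) by (simp add: r_distr m_ac)
  also have "\<dots> = v \<otimes> (\<one> \<oplus> d \<otimes> g) \<otimes> d"
    unfolding ddd using d g v(1) by (simp add: r_distr l_distr m_ac)
  also have "\<dots> = d"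
    using v d unfolding g_def by simp
  finally show ?thesis
    using v(1) d unfolding d_def by blast
qed

end


section \<open>Rings with a nil-kernel diagonal\<close>

context ring
begin

lemma comm2_self: "a \<in> carrier R \<Longrightarrow> a \<in> comm2 R a"
  by (simp add: comm2_def comm_def)

lemma comm2_subset_comm: "a \<in> carrier R \<Longrightarrow> comm2 R a \<subseteq> comm R a"
  by (auto simp: comm2_def comm_def)

text \<open>This moves the problem into a commutative ring, where interpolation and lifting of
  idempotents apply. Two members commute because the second one lies in
  \<open>comm R a\<close>.\<close>

lemma comm2_subcring:
  assumes "a \<in> carrier R"
  shows "subcring (comm2 R a) R"
proof (intro subcringI subringI)
  show "comm2 R a \<subseteq> carrier R"
    by (auto simp: comm2_def)
  show "x \<otimes> y = y \<otimes> x" if "x \<in> comm2 R a" "y \<in> comm2 R a" for x y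
    using that comm2_subset_comm[OF assms] by (auto simp: comm2_def)
  show "\<ominus> x \<in> comm2 R a" if "x \<in> comm2 R a" for x
    using that by (auto simp: comm2_def comm_def l_minus r_minus)
  show "x \<otimes> y \<in> comm2 R a" if "x \<in> comm2 R a" "y \<in> comm2 R a" for x y
  proof -
    have "x \<otimes> y \<otimes> z = z \<otimes> (x \<otimes> y)"
      if z: "z \<in> carrier R" "x \<otimes> z = z \<otimes> x" "y \<otimes> z = z \<otimes> y" "x \<in> carrier R" "y \<in> carrier R" for z
      using z by (metis m_assoc)
    then show ?thesis
      using that by (auto simp: comm2_def comm_def)
  qed
  show "x \<oplus> y \<in> comm2 R a" if "x \<in> comm2 R a" "y \<in> comm2 R a" for x y
    using that by (auto simp: comm2_def comm_def l_distr r_distr)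
qed (simp add: comm2_def comm_def)

end

text \<open>The structure of \<open>T\<^sub>n(R)\<close> used in the proof: \<open>d i\<close> reads off the \<open>i\<close>-th diagonal entry and
  \<open>D f\<close> is the diagonal matrix with entries \<open>f\<close>.\<close>

locale diagonal_ring = T: ring T + R: cring R
  for T :: "('b, 'n) ring_scheme" and R :: "('a, 'm) ring_scheme" +
  fixes n :: nat and d :: "nat \<Rightarrow> 'b \<Rightarrow> 'a" and D :: "(nat \<Rightarrow> 'a) \<Rightarrow> 'b"
  assumes d_hom: "i < n \<Longrightarrow> d i \<in> Ring.ring_hom T R"
    and D_closed: "f \<in> {..<n} \<rightarrow> carrier R \<Longrightarrow> D f \<in> carrier T"
    and d_D: "f \<in> {..<n} \<rightarrow> carrier R \<Longrightarrow> i < n \<Longrightarrow> d i (D f) = f i"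
    and scalar_central: "r \<in> carrier R \<Longrightarrow> x \<in> carrier T \<Longrightarrow>
      D (\<lambda>_. r) \<otimes>\<^bsub>T\<^esub> x = x \<otimes>\<^bsub>T\<^esub> D (\<lambda>_. r)"
    and kernel_nil: "x \<in> carrier T \<Longrightarrow> (\<And>i. i < n \<Longrightarrow> d i x = \<zero>\<^bsub>R\<^esub>) \<Longrightarrow>
      \<exists>k::nat. x [^]\<^bsub>T\<^esub> k = \<zero>\<^bsub>T\<^esub>"
begin

lemmas d_simps = ring_hom_closed[OF d_hom] ring_hom_mult[OF d_hom] ring_hom_add[OF d_hom]
  ring_hom_one[OF d_hom] ring_hom_zero[OF d_hom T.ring_axioms R.ring_axioms]
  ring_hom_minus[OF T.ring_axioms R.ring_axioms d_hom]

text \<open>Left inverses of the diagonal entries of z = 1 + yx form a diagonal matrix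
  \<open>D f\<close> such that the product of \<open>D f\<close> and z has diagonal 1. It equals 1 -
  N with N nilpotent, so it has a left inverse, and hence so has z.\<close>

lemma jacobson_radical_diagonalI:
  assumes x: "x \<in> carrier T" and dx: "\<And>i. i < n \<Longrightarrow> d i x \<in> jacobson_radical R"
  shows "x \<in> jacobson_radical T"
proof (rule T.jacobson_radicalI[OF x])
  fix y assume y: "y \<in> carrier T"
  let ?z = "\<one>\<^bsub>T\<^esub> \<oplus>\<^bsub>T\<^esub> y \<otimes>\<^bsub>T\<^esub> x"
  have z: "?z \<in> carrier T"
    using x y by simp
  have "\<exists>v\<in>carrier R. v \<otimes>\<^bsub>R\<^esub> d i ?z = \<one>\<^bsub>R\<^esub>" if "i < n" for i
    using R.jacobson_radical_left_inverse[OF R.left_idealE(5)[OF R.left_ideal_jacobson_radical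
        d_simps(1)[OF that y] dx[OF that]]] that x y
    by (simp add: d_simps)
  then have "\<forall>i\<in>{..<n}. \<exists>v. v \<in> carrier R \<and> v \<otimes>\<^bsub>R\<^esub> d i ?z = \<one>\<^bsub>R\<^esub>"
    by blast
  from bchoice[OF this] obtain f
    where f: "\<forall>i\<in>{..<n}. f i \<in> carrier R \<and> f i \<otimes>\<^bsub>R\<^esub> d i ?z = \<one>\<^bsub>R\<^esub>"
    by (elim exE)
  then have f': "f \<in> {..<n} \<rightarrow> carrier R" by simp
  define N where "N = \<one>\<^bsub>T\<^esub> \<ominus>\<^bsub>T\<^esub> D f \<otimes>\<^bsub>T\<^esub> ?z"
  have Df: "D f \<in> carrier T"
    using D_closed[OF f'] .
  then have Dz: "D f \<otimes>\<^bsub>T\<^esub> ?z \<in> carrier T"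
    using z by simp
  then have N: "N \<in> carrier T"
    unfolding N_def by simp
  have "d i N = \<zero>\<^bsub>R\<^esub>" if i: "i < n" for i
  proof -
    have "d i N = \<one>\<^bsub>R\<^esub> \<ominus>\<^bsub>R\<^esub> d i (D f) \<otimes>\<^bsub>R\<^esub> d i ?z"
      unfolding N_def
      by (simp only: d_simps(6)[OF i T.one_closed Dz] d_simps(2)[OF i Df z] d_simps(4)[OF i])
    then show ?thesis
      using f i by (simp add: d_D[OF f' i] R.r_right_minus_eq)
  qed
  then obtain k :: nat where "N [^]\<^bsub>T\<^esub> k = \<zero>\<^bsub>T\<^esub>"
    using kernel_nil[OF N] by blast
  then obtain w where w: "w \<in> carrier T" "w \<otimes>\<^bsub>T\<^esub> (\<one>\<^bsub>T\<^esub> \<ominus>\<^bsub>T\<^esub> N) = \<one>\<^bsub>T\<^esub>"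
    using T.unipotent_left_inverse[OF N] by blast
  have "\<one>\<^bsub>T\<^esub> \<ominus>\<^bsub>T\<^esub> (\<one>\<^bsub>T\<^esub> \<ominus>\<^bsub>T\<^esub> p) = p" if "p \<in> carrier T" for p
    using that by algebra
  then have "w \<otimes>\<^bsub>T\<^esub> (D f \<otimes>\<^bsub>T\<^esub> ?z) = \<one>\<^bsub>T\<^esub>"
    using w(2) Dz by (simp only: N_def)
  then have "(w \<otimes>\<^bsub>T\<^esub> D f) \<otimes>\<^bsub>T\<^esub> ?z = \<one>\<^bsub>T\<^esub>"
    by (simp only: T.m_assoc[OF w(1) Df z])
  then show "\<exists>v\<in>carrier T. v \<otimes>\<^bsub>T\<^esub> ?z = \<one>\<^bsub>T\<^esub>"
    using w(1) Df by (intro bexI[of _ "w \<otimes>\<^bsub>T\<^esub> D f"]) simp_all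
qed

lemma strongly_J_clean_imp_perfectly_J_clean:
  assumes "strongly_J_clean R"
  shows "perfectly_J_clean T"
  unfolding perfectly_J_clean_def
proof
  fix a assume a: "a \<in> carrier T"
  \<comment> \<open>An idempotent constructed inside this ring lies in the double commutant
    automatically, so no commutation has to be checked for it afterwards.\<close>
  define S where "S = T\<lparr>carrier := comm2 T a\<rparr>"
  have sub: "subcring (comm2 T a) T"
    using T.comm2_subcring[OF a] .
  interpret S: cring S
    unfolding S_def using T.subcring_iff sub subcringE(1)[OF sub] by blast
  have S_simps [simp]: "carrier S = comm2 T a" "monoid.mult S = monoid.mult T" "add S = add T"
    "one S = one T" "zero S = zero T"
    by (simp_all add: S_def)
  have ST: "x \<in> carrier T" if "x \<in> comm2 T a" for x
    using that by (simp add: comm2_def)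
  have scalar: "D (\<lambda>_. r) \<in> comm2 T a" if "r \<in> carrier R" for r
    using that D_closed[of "\<lambda>_. r"] scalar_central[OF that] by (auto simp: comm2_def comm_def)
  have dS: "d i \<in> Ring.ring_hom S R" if "i < n" for i
    using ring_hom_memE[OF d_hom[OF that]] ST by (intro ring_hom_memI) simp_all
  have "\<forall>i\<in>{..<n}. \<exists>e. e \<in> carrier R \<and> e \<otimes>\<^bsub>R\<^esub> e = e \<and> d i a \<ominus>\<^bsub>R\<^esub> e \<in> jacobson_radical R"
  proof
    fix i assume "i \<in> {..<n}"
    then have "d i a \<in> carrier R"
      using a d_simps(1) by simp
    then show "\<exists>e. e \<in> carrier R \<and> e \<otimes>\<^bsub>R\<^esub> e = e \<and> d i a \<ominus>\<^bsub>R\<^esub> e \<in> jacobson_radical R"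
      using assms unfolding strongly_J_clean_def comm_def by blast
  qed
  from bchoice[OF this] obtain e where
    "\<forall>i\<in>{..<n}. e i \<in> carrier R \<and> e i \<otimes>\<^bsub>R\<^esub> e i = e i \<and> d i a \<ominus>\<^bsub>R\<^esub> e i \<in> jacobson_radical R"
    by (elim exE)
  then have e: "e i \<in> carrier R" "e i \<otimes>\<^bsub>R\<^esub> e i = e i" "d i a \<ominus>\<^bsub>R\<^esub> e i \<in> jacobson_radical R"
    if "i < n" for i
    using that by simp_all
  have pair: "\<exists>x\<in>carrier S. d i x = e i \<and> d j x = e j" if ij: "i \<in> {..<n}" "j \<in> {..<n}" for i j
  proof -
    have i: "i < n" and j: "j < n" using ij by auto
    have da: "d i a \<in> carrier R" "d j a \<in> carrier R"
      using d_simps(1) a i j by blast+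
    \<comment> \<open>The first identity writes \<open>d i a\<close> as \<open>e i\<close> plus a
      radical element, the form that \<open>idempotent_difference_solve\<close> expects.\<close>
    have *: "r \<oplus>\<^bsub>R\<^esub> (x \<ominus>\<^bsub>R\<^esub> r) = x" "r \<oplus>\<^bsub>R\<^esub> (x \<ominus>\<^bsub>R\<^esub> x) = r"
      if "r \<in> carrier R" "x \<in> carrier R" for r x
      using that by algebra+
    obtain c where c: "c \<in> carrier R" "c \<otimes>\<^bsub>R\<^esub> (d j a \<ominus>\<^bsub>R\<^esub> d i a) = e j \<ominus>\<^bsub>R\<^esub> e i"
      using R.idempotent_difference_solve[OF e(1,2)[OF i] e(1,2)[OF j] e(3)[OF i] e(3)[OF j]]
        da e(1)[OF i] e(1)[OF j]
      by (auto simp: *)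
    \<comment> \<open>At index \<open>i\<close> the factor on the right vanishes and
      \<open>e i\<close> remains; at \<open>j\<close> the choice of \<open>c\<close> adds e j - e i.
      Membership in \<open>S\<close> holds because \<open>a\<close> and all scalar matrices lie
      there.\<close>
    define x where "x = D (\<lambda>_. e i) \<oplus>\<^bsub>S\<^esub> D (\<lambda>_. c) \<otimes>\<^bsub>S\<^esub> (a \<ominus>\<^bsub>S\<^esub> D (\<lambda>_. d i a))"
    note aS = T.comm2_self[OF a] scalar[OF e(1)[OF i]] scalar[OF c(1)] scalar[OF da(1)]
    have x: "x \<in> carrier S"
      unfolding x_def using aS[folded S_simps(1)]
      by (intro S.a_closed S.m_closed S.minus_closed)
    have dx: "d h x = e i \<oplus>\<^bsub>R\<^esub> c \<otimes>\<^bsub>R\<^esub> (d h a \<ominus>\<^bsub>R\<^esub> d i a)" if h: "h < n" for h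
    proof -
      note aS' = aS[folded S_simps(1)]
      have "d h x = d h (D (\<lambda>_. e i)) \<oplus>\<^bsub>R\<^esub> d h (D (\<lambda>_. c)) \<otimes>\<^bsub>R\<^esub> (d h a \<ominus>\<^bsub>R\<^esub> d h (D (\<lambda>_. d i a)))"
        unfolding x_def
        using aS' ring_hom_add[OF dS[OF h]] ring_hom_mult[OF dS[OF h]]
          ring_hom_minus[OF S.ring_axioms R.ring_axioms dS[OF h]]
        by (simp del: S_simps)
      then show ?thesis
        using e(1)[OF i] c(1) da(1) h by (simp add: d_D)
    qed
    have "d i x = e i"
      using dx[OF i] c(1) e(1)[OF i] da(1) by (simp add: a_minus_def R.r_neg)
    moreover have "d j x = e j"
      using dx[OF j] c(2) e(1)[OF i] e(1)[OF j] by (simp add: *)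
    ultimately show ?thesis
      using x by blast
  qed
  obtain x where x: "x \<in> carrier S" "\<And>i. i < n \<Longrightarrow> d i x = e i"
    using S.interpolate_idempotents[OF R.cring_axioms, of "{..<n}" d e] dS e pair by auto
  \<comment> \<open>The diagonal of \<open>u\<close> consists of the defects of the idempotents
    \<open>e i\<close>, so it is zero and \<open>u\<close> is nilpotent.\<close>
  define u where "u = x \<otimes>\<^bsub>S\<^esub> x \<ominus>\<^bsub>S\<^esub> x"
  have u: "u \<in> carrier S"
    unfolding u_def using x(1) by (intro S.minus_closed S.m_closed)
  have "d i u = \<zero>\<^bsub>R\<^esub>" if i: "i < n" for i
  proof -
    have "d i u = d i x \<otimes>\<^bsub>R\<^esub> d i x \<ominus>\<^bsub>R\<^esub> d i x"
      unfolding u_def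
      using x(1) ring_hom_mult[OF dS[OF i]] ring_hom_minus[OF S.ring_axioms R.ring_axioms dS[OF i]]
      by (simp del: S_simps)
    then show ?thesis
      using x(2)[OF i] e[OF i] by (simp add: R.r_right_minus_eq)
  qed
  then obtain k :: nat where "u [^]\<^bsub>T\<^esub> k = \<zero>\<^bsub>T\<^esub>"
    using kernel_nil[of u] u ST by auto
  \<comment> \<open>Lifting takes place in the commutative ring \<open>S\<close>, so the vanishing
    power must be read there.\<close>
  then have "u [^]\<^bsub>S\<^esub> k = \<zero>\<^bsub>S\<^esub>"
    using T.nat_pow_consistent[of u k "comm2 T a"] by (simp add: S_def)
  then obtain f where f: "f \<in> carrier S" "f \<otimes>\<^bsub>S\<^esub> f = f" "\<forall>i\<in>{..<n}. d i f = d i x"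
    using S.lift_idempotent[OF R.cring_axioms, of "{..<n}" d x k] dS x e(2)
    unfolding u_def by auto
  have "a \<ominus>\<^bsub>T\<^esub> f \<in> jacobson_radical T"
  proof (rule jacobson_radical_diagonalI)
    show "a \<ominus>\<^bsub>T\<^esub> f \<in> carrier T"
      using a f(1) ST by simp
    show "d i (a \<ominus>\<^bsub>T\<^esub> f) \<in> jacobson_radical R" if "i < n" for i
      using that a f(1,3) ST x(2) e(3) by (simp add: d_simps)
  qed
  then show "\<exists>e\<in>comm2 T a. e \<otimes>\<^bsub>T\<^esub> e = e \<and> a \<ominus>\<^bsub>T\<^esub> e \<in> jacobson_radical T"
    using f(1,2) by auto
qed

text \<open>Idempotency and the radical condition are transported along \<open>d 0\<close>,
  available because n >= 1. Commutation of the image is automatic in the commutative ring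
  \<open>R\<close>.\<close>

lemma perfectly_J_clean_imp_strongly_J_clean:
  assumes "perfectly_J_clean T" "n \<ge> 1"
  shows "strongly_J_clean R"
  unfolding strongly_J_clean_def
proof
  fix r assume r: "r \<in> carrier R"
  have n: "0 < n" using assms(2) by simp
  have surj: "d 0 ` carrier T = carrier R"
  proof
    show "d 0 ` carrier T \<subseteq> carrier R"
      using d_simps(1)[OF n] by blast
    show "carrier R \<subseteq> d 0 ` carrier T"
    proof
      fix s assume "s \<in> carrier R"
      then have "D (\<lambda>_. s) \<in> carrier T" "d 0 (D (\<lambda>_. s)) = s"
        using D_closed[of "\<lambda>_. s"] d_D[of "\<lambda>_. s" 0] n by auto
      then show "s \<in> d 0 ` carrier T" by (metis imageI)
    qed
  qed
  then obtain a where a: "a \<in> carrier T" "d 0 a = r"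
    using r by (metis imageE)
  obtain e where e: "e \<in> carrier T" "e \<otimes>\<^bsub>T\<^esub> e = e" "a \<ominus>\<^bsub>T\<^esub> e \<in> jacobson_radical T"
    using bspec[OF assms(1)[unfolded perfectly_J_clean_def] a(1)] by (auto simp: comm2_def)
  have "d 0 (a \<ominus>\<^bsub>T\<^esub> e) \<in> jacobson_radical R"
    using surj_ring_hom_jacobson_radical[OF T.ring_axioms R.ring_axioms d_hom[OF n] surj e(3)] .
  then have "r \<ominus>\<^bsub>R\<^esub> d 0 e \<in> jacobson_radical R"
    using d_simps(6)[OF n a(1) e(1)] a(2) by simp
  moreover have "d 0 e \<otimes>\<^bsub>R\<^esub> d 0 e = d 0 e"
    using d_simps(2)[OF n e(1) e(1)] e(2) by simp
  moreover have "d 0 e \<in> comm R r"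
    using d_simps(1)[OF n e(1)] r by (simp add: comm_def R.m_comm)
  ultimately show "\<exists>e\<in>comm R r. e \<otimes>\<^bsub>R\<^esub> e = e \<and> r \<ominus>\<^bsub>R\<^esub> e \<in> jacobson_radical R"
    by (intro bexI[of _ "d 0 e"] conjI)
qed

end

section \<open>Triangular matrices\<close>

text \<open>Evaluates entries of matrix products in which a single summand survives.\<close>

lemma (in abelian_monoid) finsum_eq_single:
  assumes "finite K" "i \<in> K" "f i \<in> carrier G" "\<And>k. k \<in> K \<Longrightarrow> k \<noteq> i \<Longrightarrow> f k = \<zero>"
  shows "finsum G f K = f i"
proof -
  have "finsum G f K = (\<Oplus>k\<in>K. if i = k then f k else \<zero>)"
    using assms by (intro finsum_cong') auto
  also have "\<dots> = (\<Oplus>k\<in>K. if i = k then (\<lambda>_. f i) k else \<zero>)"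
    using assms by (intro finsum_cong') auto
  also have "\<dots> = f i"
    using assms by (intro finsum_singleton) auto
  finally show ?thesis .
qed

context ring
begin

section \<open>The full matrix ring\<close>

lemma mem_matrix_ring:
  "A \<in> carrier (matrix_ring n R) \<longleftrightarrow>
     A \<in> carrier_mat n n \<and> (\<forall>i<n. \<forall>j<n. A $$ (i, j) \<in> carrier R)"
  by (fastforce simp: matrix_ring_def)

lemma matrix_ring_dims [simp]:
  assumes "A \<in> carrier (matrix_ring n R)"
  shows "dim_row A = n" "dim_col A = n"
  using assms by (auto simp: mem_matrix_ring)

lemma matrix_ring_entry [simp]:
  "A \<in> carrier (matrix_ring n R) \<Longrightarrow> i < n \<Longrightarrow> j < n \<Longrightarrow> A $$ (i, j) \<in> carrier R"
  by (simp add: mem_matrix_ring)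

lemma matrix_ring_eqI:
  assumes "A \<in> carrier (matrix_ring n R)" "B \<in> carrier (matrix_ring n R)"
    and "\<And>i j. i < n \<Longrightarrow> j < n \<Longrightarrow> A $$ (i, j) = B $$ (i, j)"
  shows "A = B"
  using assms by (intro eq_matI) simp_all

lemma mat_mem_matrix_ring:
  "(\<And>i j. i < n \<Longrightarrow> j < n \<Longrightarrow> f (i, j) \<in> carrier R) \<Longrightarrow> mat n n f \<in> carrier (matrix_ring n R)"
  by (simp add: mem_matrix_ring)

lemma matrix_ring_index:
  assumes "i < n" "j < n"
  shows "(A \<otimes>\<^bsub>matrix_ring n R\<^esub> B) $$ (i, j) = (\<Oplus>k\<in>{..<n}. A $$ (i, k) \<otimes> B $$ (k, j))"
    and "(A \<oplus>\<^bsub>matrix_ring n R\<^esub> B) $$ (i, j) = A $$ (i, j) \<oplus> B $$ (i, j)"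
    and "\<one>\<^bsub>matrix_ring n R\<^esub> $$ (i, j) = (if i = j then \<one> else \<zero>)"
    and "\<zero>\<^bsub>matrix_ring n R\<^esub> $$ (i, j) = \<zero>"
  using assms by (simp_all add: matrix_ring_def)

lemma matrix_ring_closed:
  shows "A \<in> carrier (matrix_ring n R) \<Longrightarrow> B \<in> carrier (matrix_ring n R) \<Longrightarrow>
      A \<otimes>\<^bsub>matrix_ring n R\<^esub> B \<in> carrier (matrix_ring n R)"
    and "A \<in> carrier (matrix_ring n R) \<Longrightarrow> B \<in> carrier (matrix_ring n R) \<Longrightarrow>
      A \<oplus>\<^bsub>matrix_ring n R\<^esub> B \<in> carrier (matrix_ring n R)"
    and "\<one>\<^bsub>matrix_ring n R\<^esub> \<in> carrier (matrix_ring n R)"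
    and "\<zero>\<^bsub>matrix_ring n R\<^esub> \<in> carrier (matrix_ring n R)"
  by (simp_all add: mem_matrix_ring)
    (simp_all add: matrix_ring_def mem_matrix_ring[unfolded matrix_ring_def])

text \<open>Distributivity expands one side to a double sum over k and l; exchanging the two
  summations and factoring again gives the other side.\<close>

lemma matrix_ring_assoc:
  assumes A: "A \<in> carrier (matrix_ring n R)" and B: "B \<in> carrier (matrix_ring n R)"
    and C: "C \<in> carrier (matrix_ring n R)"
  shows "A \<otimes>\<^bsub>matrix_ring n R\<^esub> B \<otimes>\<^bsub>matrix_ring n R\<^esub> C =
    A \<otimes>\<^bsub>matrix_ring n R\<^esub> (B \<otimes>\<^bsub>matrix_ring n R\<^esub> C)"
proof (rule matrix_ring_eqI)
  fix i j assume i: "i < n" and j: "j < n"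
  have "(A \<otimes>\<^bsub>matrix_ring n R\<^esub> B \<otimes>\<^bsub>matrix_ring n R\<^esub> C) $$ (i, j) =
    (\<Oplus>k\<in>{..<n}. (\<Oplus>l\<in>{..<n}. A $$ (i, l) \<otimes> B $$ (l, k)) \<otimes> C $$ (k, j))"
    unfolding matrix_ring_index(1)[OF i j]
    using A B C i j by (intro finsum_cong') (auto simp: matrix_ring_index(1) intro!: finsum_closed)
  also have "\<dots> = (\<Oplus>k\<in>{..<n}. \<Oplus>l\<in>{..<n}. A $$ (i, l) \<otimes> B $$ (l, k) \<otimes> C $$ (k, j))"
    using A B C i j by (intro finsum_cong' finsum_ldistr) (auto intro!: finsum_closed)
  also have "\<dots> = (\<Oplus>l\<in>{..<n}. \<Oplus>k\<in>{..<n}. A $$ (i, l) \<otimes> B $$ (l, k) \<otimes> C $$ (k, j))"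
    using A B C i j by (intro finsum_finsum_swap) auto
  also have "\<dots> = (\<Oplus>l\<in>{..<n}. A $$ (i, l) \<otimes> (\<Oplus>k\<in>{..<n}. B $$ (l, k) \<otimes> C $$ (k, j)))"
  proof (intro finsum_cong')
    fix l assume l: "l \<in> {..<n}"
    have "(\<Oplus>k\<in>{..<n}. A $$ (i, l) \<otimes> B $$ (l, k) \<otimes> C $$ (k, j)) =
      (\<Oplus>k\<in>{..<n}. A $$ (i, l) \<otimes> (B $$ (l, k) \<otimes> C $$ (k, j)))"
      using A B C i j l by (intro finsum_cong') (auto simp: m_assoc)
    also have "\<dots> = A $$ (i, l) \<otimes> (\<Oplus>k\<in>{..<n}. B $$ (l, k) \<otimes> C $$ (k, j))"
      using A B C i j l by (intro finsum_rdistr[symmetric]) auto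
    finally show "(\<Oplus>k\<in>{..<n}. A $$ (i, l) \<otimes> B $$ (l, k) \<otimes> C $$ (k, j)) =
      A $$ (i, l) \<otimes> (\<Oplus>k\<in>{..<n}. B $$ (l, k) \<otimes> C $$ (k, j))" .
  qed (use A B C i j in \<open>auto intro!: finsum_closed\<close>)
  also have "\<dots> = (A \<otimes>\<^bsub>matrix_ring n R\<^esub> (B \<otimes>\<^bsub>matrix_ring n R\<^esub> C)) $$ (i, j)"
    unfolding matrix_ring_index(1)[OF i j]
    using A B C i j by (intro finsum_cong') (auto simp: matrix_ring_index(1) intro!: finsum_closed)
  finally show "(A \<otimes>\<^bsub>matrix_ring n R\<^esub> B \<otimes>\<^bsub>matrix_ring n R\<^esub> C) $$ (i, j) =
    (A \<otimes>\<^bsub>matrix_ring n R\<^esub> (B \<otimes>\<^bsub>matrix_ring n R\<^esub> C)) $$ (i, j)" .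
qed (use A B C in \<open>simp_all add: matrix_ring_closed\<close>)

text \<open>For constant \<open>f\<close> with value 1 this yields the unit laws, for constant
  \<open>f\<close> with value \<open>r\<close> the centrality of scalar matrices over a commutative
  ring.\<close>

lemma diagonal_mult_index:
  assumes A: "A \<in> carrier (matrix_ring n R)" and f: "f \<in> {..<n} \<rightarrow> carrier R" and i: "i < n" and j: "j < n"
  shows "(mat n n (\<lambda>(i, j). if i = j then f i else \<zero>) \<otimes>\<^bsub>matrix_ring n R\<^esub> A) $$ (i, j) = f i \<otimes> A $$ (i, j)"
    and "(A \<otimes>\<^bsub>matrix_ring n R\<^esub> mat n n (\<lambda>(i, j). if i = j then f i else \<zero>)) $$ (i, j) = A $$ (i, j) \<otimes> f j"
proof -
  have f': "f k \<in> carrier R" if "k < n" for k using f that by auto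
  show "(mat n n (\<lambda>(i, j). if i = j then f i else \<zero>) \<otimes>\<^bsub>matrix_ring n R\<^esub> A) $$ (i, j) = f i \<otimes> A $$ (i, j)"
    unfolding matrix_ring_index(1)[OF i j] using A f' i j
    by (subst finsum_eq_single[of _ i]) auto
  show "(A \<otimes>\<^bsub>matrix_ring n R\<^esub> mat n n (\<lambda>(i, j). if i = j then f i else \<zero>)) $$ (i, j) = A $$ (i, j) \<otimes> f j"
    unfolding matrix_ring_index(1)[OF i j] using A f' i j
    by (subst finsum_eq_single[of _ j]) auto
qed

lemma one_matrix_ring_eq:
  "\<one>\<^bsub>matrix_ring n R\<^esub> = mat n n (\<lambda>(i, j). if i = j then (\<lambda>_. \<one>) i else \<zero>)"
  by (simp add: matrix_ring_def)

lemma ring_matrix_ring: "ring (matrix_ring n R)"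
proof (rule ringI)
  note index = matrix_ring_index and closed = matrix_ring_closed
  show "abelian_group (matrix_ring n R)"
  proof (rule abelian_groupI)
    fix A B C assume A: "A \<in> carrier (matrix_ring n R)"
    show "\<exists>B\<in>carrier (matrix_ring n R). B \<oplus>\<^bsub>matrix_ring n R\<^esub> A = \<zero>\<^bsub>matrix_ring n R\<^esub>"
    proof
      show B: "mat n n (\<lambda>ij. \<ominus> (A $$ ij)) \<in> carrier (matrix_ring n R)"
        using A by (intro mat_mem_matrix_ring) simp
      show "mat n n (\<lambda>ij. \<ominus> (A $$ ij)) \<oplus>\<^bsub>matrix_ring n R\<^esub> A = \<zero>\<^bsub>matrix_ring n R\<^esub>"
        using A B by (intro matrix_ring_eqI[where n = n]) (simp_all add: index closed l_neg)
    qed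
    show "\<zero>\<^bsub>matrix_ring n R\<^esub> \<oplus>\<^bsub>matrix_ring n R\<^esub> A = A"
      using A by (intro matrix_ring_eqI[where n = n]) (simp_all add: index closed)
    assume B: "B \<in> carrier (matrix_ring n R)"
    show "A \<oplus>\<^bsub>matrix_ring n R\<^esub> B = B \<oplus>\<^bsub>matrix_ring n R\<^esub> A"
      using A B by (intro matrix_ring_eqI[where n = n]) (simp_all add: index closed a_comm)
    assume C: "C \<in> carrier (matrix_ring n R)"
    show "A \<oplus>\<^bsub>matrix_ring n R\<^esub> B \<oplus>\<^bsub>matrix_ring n R\<^esub> C = A \<oplus>\<^bsub>matrix_ring n R\<^esub> (B \<oplus>\<^bsub>matrix_ring n R\<^esub> C)"
      using A B C by (intro matrix_ring_eqI[where n = n]) (simp_all add: index closed a_assoc)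
  qed (simp_all add: closed)
  show "monoid (matrix_ring n R)"
  proof (rule monoidI)
    fix A assume A: "A \<in> carrier (matrix_ring n R)"
    show "\<one>\<^bsub>matrix_ring n R\<^esub> \<otimes>\<^bsub>matrix_ring n R\<^esub> A = A"
    proof (rule matrix_ring_eqI)
      fix i j assume "i < n" "j < n"
      then show "(\<one>\<^bsub>matrix_ring n R\<^esub> \<otimes>\<^bsub>matrix_ring n R\<^esub> A) $$ (i, j) = A $$ (i, j)"
        unfolding one_matrix_ring_eq using A by (subst diagonal_mult_index(1)) simp_all
    qed (use A in \<open>simp_all add: closed\<close>)
    show "A \<otimes>\<^bsub>matrix_ring n R\<^esub> \<one>\<^bsub>matrix_ring n R\<^esub> = A"
    proof (rule matrix_ring_eqI)
      fix i j assume "i < n" "j < n"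
      then show "(A \<otimes>\<^bsub>matrix_ring n R\<^esub> \<one>\<^bsub>matrix_ring n R\<^esub>) $$ (i, j) = A $$ (i, j)"
        unfolding one_matrix_ring_eq using A by (subst diagonal_mult_index(2)) simp_all
    qed (use A in \<open>simp_all add: closed\<close>)
  qed (simp_all add: closed matrix_ring_assoc)
  fix A B C assume A: "A \<in> carrier (matrix_ring n R)" and B: "B \<in> carrier (matrix_ring n R)"
    and C: "C \<in> carrier (matrix_ring n R)"
  show "(A \<oplus>\<^bsub>matrix_ring n R\<^esub> B) \<otimes>\<^bsub>matrix_ring n R\<^esub> C =
    A \<otimes>\<^bsub>matrix_ring n R\<^esub> C \<oplus>\<^bsub>matrix_ring n R\<^esub> B \<otimes>\<^bsub>matrix_ring n R\<^esub> C"
  proof (rule matrix_ring_eqI)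
    fix i j assume ij: "i < n" "j < n"
    have "(\<Oplus>k\<in>{..<n}. (A \<oplus>\<^bsub>matrix_ring n R\<^esub> B) $$ (i, k) \<otimes> C $$ (k, j)) =
      (\<Oplus>k\<in>{..<n}. A $$ (i, k) \<otimes> C $$ (k, j) \<oplus> B $$ (i, k) \<otimes> C $$ (k, j))"
      using A B C ij by (intro finsum_cong') (auto simp: index l_distr)
    also have "\<dots> = (\<Oplus>k\<in>{..<n}. A $$ (i, k) \<otimes> C $$ (k, j)) \<oplus> (\<Oplus>k\<in>{..<n}. B $$ (i, k) \<otimes> C $$ (k, j))"
      using A B C ij by (intro finsum_addf) auto
    finally show "((A \<oplus>\<^bsub>matrix_ring n R\<^esub> B) \<otimes>\<^bsub>matrix_ring n R\<^esub> C) $$ (i, j) =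
      (A \<otimes>\<^bsub>matrix_ring n R\<^esub> C \<oplus>\<^bsub>matrix_ring n R\<^esub> B \<otimes>\<^bsub>matrix_ring n R\<^esub> C) $$ (i, j)"
      unfolding index(1,2)[OF ij] .
  qed (use A B C in \<open>simp_all add: closed\<close>)
  show "C \<otimes>\<^bsub>matrix_ring n R\<^esub> (A \<oplus>\<^bsub>matrix_ring n R\<^esub> B) =
    C \<otimes>\<^bsub>matrix_ring n R\<^esub> A \<oplus>\<^bsub>matrix_ring n R\<^esub> C \<otimes>\<^bsub>matrix_ring n R\<^esub> B"
  proof (rule matrix_ring_eqI)
    fix i j assume ij: "i < n" "j < n"
    have "(\<Oplus>k\<in>{..<n}. C $$ (i, k) \<otimes> (A \<oplus>\<^bsub>matrix_ring n R\<^esub> B) $$ (k, j)) =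
      (\<Oplus>k\<in>{..<n}. C $$ (i, k) \<otimes> A $$ (k, j) \<oplus> C $$ (i, k) \<otimes> B $$ (k, j))"
      using A B C ij by (intro finsum_cong') (auto simp: index r_distr)
    also have "\<dots> = (\<Oplus>k\<in>{..<n}. C $$ (i, k) \<otimes> A $$ (k, j)) \<oplus> (\<Oplus>k\<in>{..<n}. C $$ (i, k) \<otimes> B $$ (k, j))"
      using A B C ij by (intro finsum_addf) auto
    finally show "(C \<otimes>\<^bsub>matrix_ring n R\<^esub> (A \<oplus>\<^bsub>matrix_ring n R\<^esub> B)) $$ (i, j) =
      (C \<otimes>\<^bsub>matrix_ring n R\<^esub> A \<oplus>\<^bsub>matrix_ring n R\<^esub> C \<otimes>\<^bsub>matrix_ring n R\<^esub> B) $$ (i, j)"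
      unfolding index(1,2)[OF ij] .
  qed (use A B C in \<open>simp_all add: closed\<close>)
qed

section \<open>The subring of triangular matrices\<close>

lemma mem_triangular_ring:
  "A \<in> carrier (triangular_ring n R) \<longleftrightarrow>
     A \<in> carrier (matrix_ring n R) \<and> (\<forall>i<n. \<forall>j<i. A $$ (i, j) = \<zero>)"
  by (simp add: triangular_ring_def)

lemma triangular_ring_simps [simp]:
  "monoid.mult (triangular_ring n R) = monoid.mult (matrix_ring n R)"
  "add (triangular_ring n R) = add (matrix_ring n R)"
  "one (triangular_ring n R) = one (matrix_ring n R)"
  "zero (triangular_ring n R) = zero (matrix_ring n R)"
  by (simp_all add: triangular_ring_def)

text \<open>A product of entries \<open>A $$ (i, k)\<close> and \<open>B $$ (k, j)\<close> vanishes unless \<open>i + p \<le> k\<close> and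
  \<open>k + q \<le> j\<close>.\<close>

lemma banded_mult_index:
  assumes A: "A \<in> carrier (matrix_ring n R)" and B: "B \<in> carrier (matrix_ring n R)"
    and Az: "\<And>i j. i < n \<Longrightarrow> j < n \<Longrightarrow> j < i + p \<Longrightarrow> A $$ (i, j) = \<zero>"
    and Bz: "\<And>i j. i < n \<Longrightarrow> j < n \<Longrightarrow> j < i + q \<Longrightarrow> B $$ (i, j) = \<zero>"
    and ij: "i < n" "j < n" "j < i + p + q"
  shows "(A \<otimes>\<^bsub>matrix_ring n R\<^esub> B) $$ (i, j) = \<zero>"
  unfolding matrix_ring_index(1)[OF ij(1,2)]
proof (rule add.finprod_one_eqI)
  fix k assume k: "k \<in> {..<n}"
  show "A $$ (i, k) \<otimes> B $$ (k, j) = \<zero>"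
  proof (cases "k < i + p")
    case True
    then show ?thesis using Az[of i k] B ij k by simp
  next
    case False
    then show ?thesis using Bz[of k j] A ij k by simp
  qed
qed

lemma ring_triangular_ring: "ring (triangular_ring n R)"
proof -
  interpret M: ring "matrix_ring n R" by (rule ring_matrix_ring)
  have "subring (carrier (triangular_ring n R)) (matrix_ring n R)"
  proof (rule M.subringI)
    show "carrier (triangular_ring n R) \<subseteq> carrier (matrix_ring n R)"
      by (auto simp: mem_triangular_ring)
    show "\<one>\<^bsub>matrix_ring n R\<^esub> \<in> carrier (triangular_ring n R)"
      by (simp add: mem_triangular_ring matrix_ring_closed matrix_ring_index)
    fix A assume A: "A \<in> carrier (triangular_ring n R)"
    then have A': "A \<in> carrier (matrix_ring n R)" by (simp add: mem_triangular_ring)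
    show "\<ominus>\<^bsub>matrix_ring n R\<^esub> A \<in> carrier (triangular_ring n R)"
    proof -
      \<comment> \<open>The negative is given only abstractly as an additive inverse, so its entries
        are read off from A + (-A) = 0.\<close>
      have "(\<ominus>\<^bsub>matrix_ring n R\<^esub> A) $$ (i, j) = \<zero>" if ij: "i < n" "j < i" for i j
      proof -
        have j: "j < n" using ij by simp
        have "(A \<oplus>\<^bsub>matrix_ring n R\<^esub> \<ominus>\<^bsub>matrix_ring n R\<^esub> A) $$ (i, j) = \<zero>"
          using A' ij j by (simp only: M.r_neg matrix_ring_index)
        moreover have "(\<ominus>\<^bsub>matrix_ring n R\<^esub> A) $$ (i, j) \<in> carrier R"
          using M.a_inv_closed[OF A'] ij(1) j by (rule matrix_ring_entry)
        ultimately show ?thesis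
          using A ij j by (simp add: matrix_ring_index mem_triangular_ring)
      qed
      then show ?thesis using A' by (simp add: mem_triangular_ring)
    qed
    fix B assume B: "B \<in> carrier (triangular_ring n R)"
    show "A \<otimes>\<^bsub>matrix_ring n R\<^esub> B \<in> carrier (triangular_ring n R)"
      \<comment> \<open>With both bandwidths 0 the band condition is plain triangularity.\<close>
      using A B banded_mult_index[of A n B 0 0]
      by (simp add: mem_triangular_ring matrix_ring_closed)
    show "A \<oplus>\<^bsub>matrix_ring n R\<^esub> B \<in> carrier (triangular_ring n R)"
      using A B by (simp add: mem_triangular_ring matrix_ring_closed matrix_ring_index)
  qed
  then have "ring (matrix_ring n R \<lparr>carrier := carrier (triangular_ring n R)\<rparr>)"
    by (rule M.subring_is_ring)
  moreover have "matrix_ring n R \<lparr>carrier := carrier (triangular_ring n R)\<rparr> = triangular_ring n R"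
    by (simp add: triangular_ring_def)
  ultimately show ?thesis by simp
qed

text \<open>In the product sum for entry (i, i), summands with k < i vanish because of
  \<open>A\<close> and those with k > i because of \<open>B\<close>; only k = i remains.\<close>

lemma triangular_diagonal_hom:
  assumes i: "i < n"
  shows "(\<lambda>A. A $$ (i, i)) \<in> Ring.ring_hom (triangular_ring n R) R"
proof (rule ring_hom_memI)
  fix A B assume A: "A \<in> carrier (triangular_ring n R)" and B: "B \<in> carrier (triangular_ring n R)"
  show "A $$ (i, i) \<in> carrier R"
    using A i by (auto simp: mem_triangular_ring)
  have "A $$ (i, k) \<otimes> B $$ (k, i) = \<zero>" if "k < n" "k \<noteq> i" for k
    using that A B i by (cases "k < i") (auto simp: mem_triangular_ring)
  then show "(A \<otimes>\<^bsub>triangular_ring n R\<^esub> B) $$ (i, i) = A $$ (i, i) \<otimes> B $$ (i, i)"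
    unfolding triangular_ring_simps matrix_ring_index(1)[OF i i]
    using A B i by (intro finsum_eq_single) (auto simp: mem_triangular_ring)
qed (use i in \<open>simp_all add: matrix_ring_index\<close>)

text \<open>Each further factor \<open>A\<close> pushes the nonzero entries up by one superdiagonal:
  the k-th power vanishes where j < i + k, and for k = n this covers every entry.\<close>

lemma strictly_triangular_nilpotent:
  assumes A: "A \<in> carrier (triangular_ring n R)" and diag: "\<And>i. i < n \<Longrightarrow> A $$ (i, i) = \<zero>"
  shows "A [^]\<^bsub>triangular_ring n R\<^esub> n = \<zero>\<^bsub>triangular_ring n R\<^esub>"
proof -
  interpret T: ring "triangular_ring n R" by (rule ring_triangular_ring)
  have mem: "B \<in> carrier (matrix_ring n R)" if "B \<in> carrier (triangular_ring n R)" for B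
    using that by (simp add: mem_triangular_ring)
  have "A $$ (i, j) = \<zero>" if "i < n" "j < n" "j < i + 1" for i j
    using that A diag[of i] by (cases "j = i") (auto simp: mem_triangular_ring)
  then have "(A [^]\<^bsub>triangular_ring n R\<^esub> k) $$ (i, j) = \<zero>" if "i < n" "j < n" "j < i + k" for i j k
    using that
  proof (induction k arbitrary: i j)
    case 0
    then show ?case by (simp add: matrix_ring_index)
  next
    case (Suc k)
    then show ?case
      using mem[OF A] mem[OF T.nat_pow_closed[OF A]]
      by (simp add: banded_mult_index[where p = k and q = 1])
  qed
  then show ?thesis
    using mem[OF T.nat_pow_closed[OF A]]
    by (intro matrix_ring_eqI[where n = n]) (simp_all add: matrix_ring_closed matrix_ring_index)
qed

end

text \<open>Commutativity of \<open>R\<close> makes scalar matrices central: the entries of the two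
  products are r A_ij and A_ij r. The kernel of the diagonal consists of the strictly triangular
  matrices, whose n-th power is zero.\<close>

lemma (in cring) diagonal_ring_triangular_ring:
  "diagonal_ring (triangular_ring n R) R n (\<lambda>i A. A $$ (i, i))
     (\<lambda>f. mat n n (\<lambda>(i, j). if i = j then f i else \<zero>))"
proof (intro diagonal_ring.intro diagonal_ring_axioms.intro)
  have D: "mat n n (\<lambda>(i, j). if i = j then f i else \<zero>) \<in> carrier (triangular_ring n R)"
    if "f \<in> {..<n} \<rightarrow> carrier R" for f
    using that by (auto simp: mem_triangular_ring intro!: mat_mem_matrix_ring)
  then show "mat n n (\<lambda>(i, j). if i = j then f i else \<zero>) \<in> carrier (triangular_ring n R)"
    if "f \<in> {..<n} \<rightarrow> carrier R" for f
    using that .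
  fix r A assume r: "r \<in> carrier R" and A: "A \<in> carrier (triangular_ring n R)"
  let ?D = "mat n n (\<lambda>(i, j). if i = j then (\<lambda>_. r) i else \<zero>)"
  have M: "A \<in> carrier (matrix_ring n R)" "?D \<in> carrier (matrix_ring n R)"
    using A D[of "\<lambda>_. r"] r by (auto simp: mem_triangular_ring)
  have "?D \<otimes>\<^bsub>matrix_ring n R\<^esub> A = A \<otimes>\<^bsub>matrix_ring n R\<^esub> ?D"
  proof (rule matrix_ring_eqI)
    fix i j assume "i < n" "j < n"
    then show "(?D \<otimes>\<^bsub>matrix_ring n R\<^esub> A) $$ (i, j) = (A \<otimes>\<^bsub>matrix_ring n R\<^esub> ?D) $$ (i, j)"
      using M(1) r diagonal_mult_index[of A n "\<lambda>_. r"] by (simp add: m_comm)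
  qed (use M in \<open>simp_all only: matrix_ring_closed\<close>)
  then show "?D \<otimes>\<^bsub>triangular_ring n R\<^esub> A = A \<otimes>\<^bsub>triangular_ring n R\<^esub> ?D"
    by simp
next
  fix A assume "A \<in> carrier (triangular_ring n R)" "\<And>i. i < n \<Longrightarrow> A $$ (i, i) = \<zero>"
  then show "\<exists>k::nat. A [^]\<^bsub>triangular_ring n R\<^esub> k = \<zero>\<^bsub>triangular_ring n R\<^esub>"
    using strictly_triangular_nilpotent by blast
qed (simp_all add: ring_triangular_ring is_cring triangular_diagonal_hom)

theorem corollary4p12:
  fixes R :: "('a, 'm) ring_scheme"
  assumes "cring R"
  shows "(strongly_J_clean R \<longleftrightarrow> (\<forall>n\<ge>1. perfectly_J_clean (triangular_ring n R))) \<and>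
         (strongly_J_clean R \<longleftrightarrow> (\<exists>n\<ge>1. perfectly_J_clean (triangular_ring n R)))"
proof -
  interpret cring R by fact
  \<comment> \<open>Since \<open>n\<close> is arbitrary here, this serves both the universal and the
    existential form; a single \<open>n\<close> >= 1 suffices for the way back.\<close>
  have "perfectly_J_clean (triangular_ring n R)" if "strongly_J_clean R" for n
    using diagonal_ring.strongly_J_clean_imp_perfectly_J_clean[OF diagonal_ring_triangular_ring that] .
  moreover have "strongly_J_clean R" if "perfectly_J_clean (triangular_ring n R)" "n \<ge> 1" for n
    using diagonal_ring.perfectly_J_clean_imp_strongly_J_clean[OF diagonal_ring_triangular_ring that] .
  ultimately show ?thesis
    by blast
qed

end
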